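(* Let $A\in\mathbb{R}^{m\times n}$, $B\in\mathbb{R}^{l\times n}$ with $m<n$ and $l\le n$, $y\in\mathbb{R}^m$, $b\in\mathbb{R}^l$, $\epsilon\ge 0$, and let $T=\{x\in\mathbb{R}^n:\ \|y-Ax\|_2\le\epsilon,\ Bx\le b\}$. Suppose the Slater condition holds, and suppose the following assumption holds: letting $\nu$ be an arbitrary sparsest point of $T$, there exists a weight $\bar w\in\mathbb{R}^n_+$ such that (H1) the problem $(P_{\bar w})$ has an optimal solution $\bar x$ with $\|\bar x\|_0=\|\nu\|_0$; (H2) there exists an optimal solution $\bar\lambda=(\bar\lambda_1,\dots,\bar\lambda_6)$ of the dual problem $(D_{\bar w})$ such that $\bar\lambda_6$ and $\bar x$ are strictly complementary, i.e. $|\bar x|^T\bar\lambda_6=0$, $\bar\lambda_6\ge 0$ and $|\bar x|+\bar\lambda_6>0$ componentwise; (H3) the optimal value of $(P_{\bar w})$ is finite and positive. Consider the bilevel optimization problem in the variables $(w,\lambda)$, $\lambda=(\lambda_1,\dots,\lambda_6)$, $$\begin{array}{cl}\max\limits_{(w,\lambda)} & \|\lambda_6\|_0\\ \text{s.t.} & B^T\lambda_2-A^T\lambda_3+\lambda_4-\lambda_5=0,\quad \|\lambda_3\|_2\le\lambda_1,\\ & -\lambda_1\epsilon-\lambda_2^Tb+\lambda_3^Ty=\min\limits_x\{\|Wx\|_1:\ x\in T\},\\ & w=\lambda_4+\lambda_5+\lambda_6\ge 0,\quad \lambda_i\ge 0,\ i=1,2,4,5,6,\end{array}$$ where $W=\mathrm{diag}(w)$.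 If $(w^*,\lambda^* )$ is an optimal solution of this bilevel problem, then any optimal solution $x^*$ of $$\min_x\{\|W^*x\|_1:\ x\in T\},\qquad W^*=\mathrm{diag}(w^* ),$$ is a sparsest point in $T$.
   Context: $\|x\|_0$ is the number of nonzero components of a vector $x$; $|x|$ is the componentwise absolute value; vector inequalities are componentwise; $\mathbb{R}^n_+$ is the set of nonnegative vectors. A sparsest point of $T$ is a point of $T$ with minimal $\|\cdot\|_0$ among all points of $T$. For a weight $w\in\mathbb{R}^n_+$: $(P_w)$ is the weighted $\ell_1$-problem $\min_x\{\|\mathrm{diag}(w)x\|_1=w^T|x|:\ x\in T\}$. Its equivalent reformulation $(P'_w)$ is $$\min_{(x,\gamma,t)}\ w^Tt\quad\text{s.t.}\quad \|\gamma\|_2\le\epsilon,\ Bx\le b,\ \gamma=y-Ax,\ |x|\le t,\ t\ge 0,$$ with $x,t\in\mathbb{R}^n$, $\gamma\in\mathbb{R}^m$. The dual problem $(D_w)$ of $(P'_w)$, in the variables $\lambda=(\lambda_1,\dots,\lambda_6)$ with $\lambda_1\in\mathbb{R}$, $\lambda_2\in\mathbb{R}^l$, $\lambda_3\in\mathbb{R}^m$, $\lambda_4,\lambda_5,\lambda_6\in\mathbb{R}^n$, is $$\max_\lambda\ -\lambda_1\epsilon-\lambda_2^Tb+\lambda_3^Ty\quad\text{s.t.}\quad B^T\lambda_2-A^T\lambda_3+\lambda_4-\lambda_5=0,\ w=\lambda_4+\lambda_5+\lambda_6,\ \|\lambda_3\|_2\le\lambda_1,\ \lambda_i\ge0\ (i=1,2,4,5,6).$$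 Slater condition (for $(P'_w)$; it does not depend on $w$): there exists $(x,\gamma,t)$ with $x$ in the relative interior of $T$ such that $\|\gamma\|_2<\epsilon$, $Bx\le b$, $|x|\le t$, $y=Ax+\gamma$, $t\ge 0$. *)

theory Defs
  imports "HOL-Analysis.Analysis"
begin

definition l0_norm :: "real^'n \<Rightarrow> nat" where
  "l0_norm x = card {i. x $ i \<noteq> 0}"

definition l1_norm :: "real^'n \<Rightarrow> real" where
  "l1_norm x = (\<Sum>i\<in>UNIV. \<bar>x $ i\<bar>)"

definition diag_mat :: "real^'n \<Rightarrow> real^'n^'n" where
  "diag_mat w = (\<chi> i j. if i = j then w $ i else 0)"

text \<open>
  On \<^typ>\<open>real^'n\<close> the order \<open>\<le>\<close> and the absolute value are the componentwise ones of the
  library, but \<open><\<close> is not componentwise (it means \<open>\<le>\<close> and not equal), so componentwise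
  strict inequalities are written out by components. \<^const>\<open>norm\<close> is the Euclidean norm.
\<close>

definition feasible_set ::
    "real^'n^'m \<Rightarrow> real^'n^'l \<Rightarrow> real^'m \<Rightarrow> real^'l \<Rightarrow> real \<Rightarrow> (real^'n) set" where
  "feasible_set A B y b \<epsilon> = {x. norm (y - A *v x) \<le> \<epsilon> \<and> B *v x \<le> b}"

definition sparsest_point :: "(real^'n) set \<Rightarrow> real^'n \<Rightarrow> bool" where
  "sparsest_point T x \<longleftrightarrow> is_arg_min l0_norm (\<lambda>z. z \<in> T) x"

definition weighted_l1_solution :: "(real^'n) set \<Rightarrow> real^'n \<Rightarrow> real^'n \<Rightarrow> bool" where
  "weighted_l1_solution T w x \<longleftrightarrow> is_arg_min (\<lambda>z. l1_norm (diag_mat w *v z)) (\<lambda>z. z \<in> T) x"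

text \<open>The optimal value as an extended real, so that its finiteness is a meaningful condition.\<close>

definition weighted_l1_value :: "(real^'n) set \<Rightarrow> real^'n \<Rightarrow> ereal" where
  "weighted_l1_value T w = (INF x\<in>T. ereal (l1_norm (diag_mat w *v x)))"

text \<open>\<open>v\<close> is the (attained) minimum of the weighted problem.\<close>

definition weighted_l1_min :: "(real^'n) set \<Rightarrow> real^'n \<Rightarrow> real \<Rightarrow> bool" where
  "weighted_l1_min T w v \<longleftrightarrow>
     (\<exists>x. weighted_l1_solution T w x \<and> v = l1_norm (diag_mat w *v x))"

definition slater_condition ::
    "real^'n^'m \<Rightarrow> real^'n^'l \<Rightarrow> real^'m \<Rightarrow> real^'l \<Rightarrow> real \<Rightarrow> bool" where
  "slater_condition A B y b \<epsilon> \<longleftrightarrow>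
     (\<exists>x \<gamma> t. x \<in> rel_interior (feasible_set A B y b \<epsilon>) \<and> norm \<gamma> < \<epsilon> \<and> B *v x \<le> b \<and>
        \<bar>x\<bar> \<le> t \<and> y = A *v x + \<gamma> \<and> 0 \<le> t)"

record ('l::finite, 'm::finite, 'n::finite) dual_var =
  lam1 :: real
  lam2 :: "real^'l"
  lam3 :: "real^'m"
  lam4 :: "real^'n"
  lam5 :: "real^'n"
  lam6 :: "real^'n"

definition dual_feasible ::
    "real^'n^'m \<Rightarrow> real^'n^'l \<Rightarrow> real^'n \<Rightarrow> ('l, 'm, 'n) dual_var \<Rightarrow> bool" where
  "dual_feasible A B w \<mu> \<longleftrightarrow>
     transpose B *v lam2 \<mu> - transpose A *v lam3 \<mu> + lam4 \<mu> - lam5 \<mu> = 0 \<and>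
     w = lam4 \<mu> + lam5 \<mu> + lam6 \<mu> \<and>
     norm (lam3 \<mu>) \<le> lam1 \<mu> \<and>
     0 \<le> lam1 \<mu> \<and> 0 \<le> lam2 \<mu> \<and> 0 \<le> lam4 \<mu> \<and> 0 \<le> lam5 \<mu> \<and> 0 \<le> lam6 \<mu>"

definition dual_objective ::
    "real^'m \<Rightarrow> real^'l \<Rightarrow> real \<Rightarrow> ('l, 'm, 'n::finite) dual_var \<Rightarrow> real" where
  "dual_objective y b \<epsilon> \<mu> = - lam1 \<mu> * \<epsilon> - lam2 \<mu> \<bullet> b + lam3 \<mu> \<bullet> y"

definition dual_solution ::
    "real^'n^'m \<Rightarrow> real^'n^'l \<Rightarrow> real^'m \<Rightarrow> real^'l \<Rightarrow> real \<Rightarrow> real^'n \<Rightarrow>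
     ('l, 'm, 'n) dual_var \<Rightarrow> bool" where
  "dual_solution A B y b \<epsilon> w \<mu> \<longleftrightarrow> is_arg_max (dual_objective y b \<epsilon>) (dual_feasible A B w) \<mu>"

definition strictly_complementary :: "real^'n \<Rightarrow> real^'n \<Rightarrow> bool" where
  "strictly_complementary x s \<longleftrightarrow>
     \<bar>x\<bar> \<bullet> s = 0 \<and> 0 \<le> s \<and> (\<forall>i. 0 < (\<bar>x\<bar> + s) $ i)"

definition bilevel_feasible ::
    "real^'n^'m \<Rightarrow> real^'n^'l \<Rightarrow> real^'m \<Rightarrow> real^'l \<Rightarrow> real \<Rightarrow>
     (real^'n) \<times> ('l, 'm, 'n) dual_var \<Rightarrow> bool" where
  "bilevel_feasible A B y b \<epsilon> = (\<lambda>(w, \<mu>).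
     dual_feasible A B w \<mu> \<and> 0 \<le> w \<and>
     weighted_l1_min (feasible_set A B y b \<epsilon>) w (dual_objective y b \<epsilon> \<mu>))"

definition bilevel_solution ::
    "real^'n^'m \<Rightarrow> real^'n^'l \<Rightarrow> real^'m \<Rightarrow> real^'l \<Rightarrow> real \<Rightarrow>
     (real^'n) \<times> ('l, 'm, 'n) dual_var \<Rightarrow> bool" where
  "bilevel_solution A B y b \<epsilon> p \<longleftrightarrow>
     is_arg_max (\<lambda>(w, \<mu>). l0_norm (lam6 \<mu>)) (bilevel_feasible A B y b \<epsilon>) p"

end

theory Submission
  imports Defs
begin

text \<open>
  For every bilevel-feasible pair the dual value equals the primal minimum, so weak duality makes
  \<open>\<lambda>\<^sub>6\<close> complementary to every solution \<open>x\<close> of the weighted problem: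
  \<open>\<parallel>x\<parallel>\<^sub>0 + \<parallel>\<lambda>\<^sub>6\<parallel>\<^sub>0 \<le> n\<close>. Strong duality makes the strictly complementary pair of the assumption
  bilevel feasible, with \<open>\<parallel>\<lambda>\<^sub>6\<parallel>\<^sub>0 = n - \<parallel>\<nu>\<parallel>\<^sub>0\<close>. A maximiser of \<open>\<parallel>\<lambda>\<^sub>6\<parallel>\<^sub>0\<close> does at least
  as well, hence \<open>\<parallel>x\<parallel>\<^sub>0 \<le> \<parallel>\<nu>\<parallel>\<^sub>0\<close>.
\<close>

section \<open>Farkas' lemma for a finite system of affine inequalities\<close>

text \<open>The consequences derivable with multipliers form a convex cone in the pairs
  \<open>(a, c)\<close>. It contains a finitely generated, hence closed, cone, so a pair outside the
  latter could be strictly separated from it. The separating functional then yields a solution of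
  the system violating \<open>a \<bullet> x \<le> c\<close>.\<close>

lemma affine_farkas:
  fixes g :: "'i::finite \<Rightarrow> 'a::euclidean_space" and d :: "'i \<Rightarrow> real"
  assumes x0: "\<And>i. g i \<bullet> x0 \<le> d i"
    and imp: "\<And>x. (\<And>i. g i \<bullet> x \<le> d i) \<Longrightarrow> a \<bullet> x \<le> c"
  obtains u where "\<And>i. 0 \<le> u i" "a = (\<Sum>i\<in>UNIV. u i *\<^sub>R g i)" "(\<Sum>i\<in>UNIV. u i * d i) \<le> c"
proof -
  \<comment> \<open>The generator \<open>(0, 1)\<close> allows \<open>c\<close> to be weakened,
    which is why \<open>K\<close> has an inequality in its second component.\<close>
  define G where "G = insert (0, 1) (range (\<lambda>i. (g i, d i)))"
  define K where "K = {p. \<exists>u. (\<forall>i. 0 \<le> u i) \<and> fst p = (\<Sum>i\<in>UNIV. u i *\<^sub>R g i) \<and>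
    (\<Sum>i\<in>UNIV. u i * d i) \<le> snd p}"
  have "convex_cone K"
    unfolding convex_cone_iff
  proof (intro conjI ballI allI impI)
    show "0 \<in> K"
      unfolding K_def by (auto intro!: exI[of _ "\<lambda>_. 0"])
  next
    fix p q assume "p \<in> K" "q \<in> K"
    then obtain u v where "\<forall>i. 0 \<le> u i" "fst p = (\<Sum>i\<in>UNIV. u i *\<^sub>R g i)"
        "(\<Sum>i\<in>UNIV. u i * d i) \<le> snd p"
        "\<forall>i. 0 \<le> v i" "fst q = (\<Sum>i\<in>UNIV. v i *\<^sub>R g i)" "(\<Sum>i\<in>UNIV. v i * d i) \<le> snd q"
      unfolding K_def by blast
    then show "p + q \<in> K"
      unfolding K_def
      by (auto intro!: exI[of _ "\<lambda>i. u i + v i"] simp: algebra_simps sum.distrib)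
  next
    fix p and r :: real assume "p \<in> K" "0 \<le> r"
    then obtain u where "\<forall>i. 0 \<le> u i" "fst p = (\<Sum>i\<in>UNIV. u i *\<^sub>R g i)"
        "(\<Sum>i\<in>UNIV. u i * d i) \<le> snd p"
      unfolding K_def by blast
    then show "r *\<^sub>R p \<in> K"
      unfolding K_def using \<open>0 \<le> r\<close>
      by (auto intro!: exI[of _ "\<lambda>i. r * u i"] mult_left_mono
          simp: scaleR_sum_right mult.assoc simp flip: sum_distrib_left)
  qed
  moreover have "G \<subseteq> K"
  proof -
    have "(0, 1) \<in> K"
      unfolding K_def by (auto intro!: exI[of _ "\<lambda>_. 0"])
    moreover have "(g i, d i) \<in> K" for i
      unfolding K_def
      by (auto intro!: exI[of _ "\<lambda>j. if j = i then 1 else 0"] simp: if_distrib[of "\<lambda>r. r *\<^sub>R _"]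
          if_distrib[of "\<lambda>r. r * _"] cong: if_cong)
    ultimately show ?thesis
      unfolding G_def by auto
  qed
  ultimately have "convex_cone hull G \<subseteq> K"
    by (metis hull_minimal)
  moreover have "(a, c) \<in> convex_cone hull G"
  proof (rule ccontr)
    assume "(a, c) \<notin> convex_cone hull G"
    moreover have "closed (convex_cone hull G)"
      unfolding G_def by (intro closed_convex_cone_hull) auto
    ultimately obtain h \<beta> where sep: "h \<bullet> (a, c) < \<beta>" "\<And>p. p \<in> convex_cone hull G \<Longrightarrow> h \<bullet> p > \<beta>"
      using separating_hyperplane_closed_point[OF convex_convex_cone_hull] by metis
    have "\<beta> < 0"
      using sep(2)[OF convex_cone_hull_contains_0] by simp
    have gen: "0 \<le> h \<bullet> p" if "p \<in> G" for p
    proof (rule ccontr)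
      assume neg: "\<not> 0 \<le> h \<bullet> p"
      \<comment> \<open>Both numbers are negative, so this is a positive multiple of the generator;
        \<open>h\<close> takes exactly the value \<open>\<beta>\<close> on it, against strict
        separation.\<close>
      have "(\<beta> / (h \<bullet> p)) *\<^sub>R p \<in> convex_cone hull G"
        using \<open>p \<in> G\<close> \<open>\<beta> < 0\<close> neg
        by (intro convex_cone_hull_mul hull_inc) (auto simp: divide_nonpos_neg)
      from sep(2)[OF this] neg show False by simp
    qed
    obtain x s where h: "h = (x, s)" by (cases h)
    have "0 \<le> s" and g: "0 \<le> g i \<bullet> x + s * d i" for i
      using gen[of "(0, 1)"] gen[of "(g i, d i)"] by (auto simp: G_def h inner_commute)
    have neg: "a \<bullet> x + s * c < 0"
      using sep(1) \<open>\<beta> < 0\<close> by (simp add: h inner_commute mult.commute)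
    show False
    proof (cases "s = 0")
      case False
      with \<open>0 \<le> s\<close> have "0 < s" by simp
      \<comment> \<open>For \<open>s > 0\<close> the functional can be normalised to last component
        1: \<open>- x / s\<close> solves the system, yet \<open>neg\<close> puts \<open>a\<close>
        above \<open>c\<close> there.\<close>
      have "a \<bullet> ((- 1 / s) *\<^sub>R x) \<le> c"
      proof (rule imp)
        fix i show "g i \<bullet> ((- 1 / s) *\<^sub>R x) \<le> d i"
          using g[of i] \<open>0 < s\<close> by (simp add: field_simps)
      qed
      with neg \<open>0 < s\<close> show False by (simp add: field_simps)
    next
      case True
      \<comment> \<open>Here \<open>- x\<close> is a recession direction along which \<open>a\<close> is unbounded above.\<close>
      define k where "k = max 0 ((c - a \<bullet> x0 + 1) / - (a \<bullet> x))"
      have "a \<bullet> (x0 - k *\<^sub>R x) \<le> c"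
      proof (rule imp)
        fix i
        have "0 \<le> k * (g i \<bullet> x)"
          using g[of i] True by (auto simp: k_def intro!: mult_nonneg_nonneg)
        with x0[of i] show "g i \<bullet> (x0 - k *\<^sub>R x) \<le> d i"
          by (simp add: inner_diff_right)
      qed
      \<comment> \<open>The right side is \<open>c - a \<bullet> x0 + 1\<close>, so \<open>a\<close>
        is at least \<open>c + 1\<close> at the shifted point.\<close>
      moreover have "k * - (a \<bullet> x) \<ge> (c - a \<bullet> x0 + 1) / - (a \<bullet> x) * - (a \<bullet> x)"
        using neg True by (intro mult_right_mono) (auto simp: k_def)
      ultimately show False
        using neg True by (simp add: inner_diff_right)
    qed
  qed
  ultimately have "(a, c) \<in> K" by blast
  then show ?thesis
    using that unfolding K_def by auto
qed

section \<open>The weighted norm and weak duality\<close>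

lemma l1_norm_diag_mat:
  assumes "0 \<le> w"
  shows "l1_norm (diag_mat w *v x) = w \<bullet> \<bar>x\<bar>"
proof -
  have "(diag_mat w *v x) $ i = w $ i * x $ i" for i
    by (simp add: diag_mat_def matrix_vector_mult_def if_distrib[of "\<lambda>r. r * _"] cong: if_cong)
  then show ?thesis
    using assms by (simp add: l1_norm_def inner_vec_def abs_mult less_eq_vec_def abs_vec_def)
qed

lemma inner_nonneg_vec: "0 \<le> u \<Longrightarrow> 0 \<le> v \<Longrightarrow> 0 \<le> u \<bullet> v" for u v :: "real^'n"
  by (simp add: inner_vec_def less_eq_vec_def sum_nonneg)

text \<open>The term \<open>lam6 \<mu> \<bullet> \<bar>x\<bar>\<close>, usually dropped, is kept:
  once primal and dual values agree, it forces complementarity.\<close>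

lemma weak_duality:
  assumes "dual_feasible A B w \<mu>" and "x \<in> feasible_set A B y b \<epsilon>"
  shows "dual_objective y b \<epsilon> \<mu> + lam6 \<mu> \<bullet> \<bar>x\<bar> \<le> w \<bullet> \<bar>x\<bar>"
proof -
  have feas: "transpose B *v lam2 \<mu> - transpose A *v lam3 \<mu> + lam4 \<mu> - lam5 \<mu> = 0"
      "w = lam4 \<mu> + lam5 \<mu> + lam6 \<mu>" "norm (lam3 \<mu>) \<le> lam1 \<mu>"
      "0 \<le> lam2 \<mu>" "0 \<le> lam4 \<mu>" "0 \<le> lam5 \<mu>"
    using assms(1) by (auto simp: dual_feasible_def)
  have x: "norm (y - A *v x) \<le> \<epsilon>" "0 \<le> b - B *v x"
    using assms(2) by (auto simp: feasible_set_def)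
  \<comment> \<open>Pairing the dual equation with \<open>x\<close> trades the transposes for
    \<open>A *v x\<close> and \<open>B *v x\<close>, which primal feasibility controls.\<close>
  have "(transpose B *v lam2 \<mu> - transpose A *v lam3 \<mu> + lam4 \<mu> - lam5 \<mu>) \<bullet> x = 0"
    unfolding feas(1) by simp
  then have eq: "lam3 \<mu> \<bullet> (A *v x) = lam2 \<mu> \<bullet> (B *v x) + (lam4 \<mu> - lam5 \<mu>) \<bullet> x"
    by (simp add: inner_diff_left inner_add_left dot_lmul_matrix)
  have "lam3 \<mu> \<bullet> (y - A *v x) \<le> norm (lam3 \<mu>) * norm (y - A *v x)"
    by (rule norm_cauchy_schwarz)
  also have "\<dots> \<le> lam1 \<mu> * \<epsilon>"
    using feas(3) x(1) by (intro mult_mono) (auto intro: order_trans[OF norm_ge_zero])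
  finally have "lam3 \<mu> \<bullet> y \<le> lam1 \<mu> * \<epsilon> + lam2 \<mu> \<bullet> (B *v x) + (lam4 \<mu> - lam5 \<mu>) \<bullet> x"
    using eq by (simp add: inner_diff_right)
  moreover have "lam2 \<mu> \<bullet> (B *v x) \<le> lam2 \<mu> \<bullet> b"
    using inner_nonneg_vec[OF feas(4) x(2)] by (simp add: inner_diff_right)
  moreover have "(lam4 \<mu> - lam5 \<mu>) \<bullet> x \<le> (lam4 \<mu> + lam5 \<mu>) \<bullet> \<bar>x\<bar>"
    unfolding inner_vec_def
  proof (rule sum_mono)
    fix i
    have "0 \<le> lam4 \<mu> $ i" "0 \<le> lam5 \<mu> $ i"
      using feas(5,6) by (simp_all add: less_eq_vec_def)
    then have "lam4 \<mu> $ i * x $ i \<le> lam4 \<mu> $ i * \<bar>x $ i\<bar>"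
        "lam5 \<mu> $ i * - (x $ i) \<le> lam5 \<mu> $ i * \<bar>x $ i\<bar>"
      by (intro mult_left_mono; simp)+
    then show "(lam4 \<mu> - lam5 \<mu>) $ i \<bullet> x $ i \<le> (lam4 \<mu> + lam5 \<mu>) $ i \<bullet> \<bar>x\<bar> $ i"
      by (simp add: abs_vec_def algebra_simps)
  qed
  ultimately show ?thesis
    by (simp add: dual_objective_def feas(2) inner_add_left)
qed

section \<open>Strong duality under the Slater condition\<close>

text \<open>This is the linear programming half of strong duality, with the residual multiplier
  already fixed inside \<open>a\<close> and \<open>c\<close>. A bound variable \<open>t\<close> with
  \<open>\<bar>x\<bar> \<le> t\<close> makes the problem linear in \<open>(x, t)\<close>, and
  Farkas' lemma applies.\<close>

lemma polyhedral_multipliers: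
  fixes B :: "real^'n^'l" and w a :: "real^'n"
  assumes "0 \<le> w" and x0: "B *v x0 \<le> b"
    and bound: "\<And>x. B *v x \<le> b \<Longrightarrow> c \<le> w \<bullet> \<bar>x\<bar> - a \<bullet> x"
  obtains l2 l4 l5 l6 where "0 \<le> l2" "0 \<le> l4" "0 \<le> l5" "0 \<le> l6"
    "a = transpose B *v l2 + l4 - l5" "w = l4 + l5 + l6" "c \<le> - (l2 \<bullet> b)"
proof -
  \<comment> \<open>The four blocks encode \<open>B *v x \<le> b\<close>, \<open>x \<le> t\<close>,
    \<open>- x \<le> t\<close> and \<open>0 \<le> t\<close>; their multipliers become
    \<open>l2\<close>, \<open>l4\<close>, \<open>l5\<close> and \<open>l6\<close>.\<close>
  define g :: "'l + 'n + 'n + 'n \<Rightarrow> (real^'n) \<times> (real^'n)" where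
    "g = case_sum (\<lambda>j. (row j B, 0)) (case_sum (\<lambda>i. (axis i 1, - axis i 1))
      (case_sum (\<lambda>i. (- axis i 1, - axis i 1)) (\<lambda>i. (0, - axis i 1))))"
  define d :: "'l + 'n + 'n + 'n \<Rightarrow> real" where
    "d = case_sum (\<lambda>j. b $ j) (\<lambda>_. 0)"
  have row: "row j B \<bullet> x = (B *v x) $ j" for j x
    by (simp add: matrix_vector_mul_component row_def)
  have constr: "(\<forall>k. g k \<bullet> (x, t) \<le> d k) \<longleftrightarrow> B *v x \<le> b \<and> \<bar>x\<bar> \<le> t" for x t
  proof -
    have "(\<forall>k. g k \<bullet> (x, t) \<le> d k) \<longleftrightarrow>
      (\<forall>j. (B *v x) $ j \<le> b $ j) \<and> (\<forall>i. x $ i \<le> t $ i \<and> - x $ i \<le> t $ i \<and> 0 \<le> t $ i)"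
      by (auto simp: g_def d_def split_sum_all row inner_axis')
    also have "\<dots> \<longleftrightarrow> B *v x \<le> b \<and> \<bar>x\<bar> \<le> t"
    proof -
      have "x $ i \<le> t $ i \<and> - x $ i \<le> t $ i \<and> 0 \<le> t $ i \<longleftrightarrow> \<bar>x $ i\<bar> \<le> t $ i" for i
        by auto
      then show ?thesis
        by (simp add: less_eq_vec_def abs_vec_def)
    qed
    finally show ?thesis .
  qed
  \<comment> \<open>As \<open>0 \<le> w\<close>, replacing \<open>t\<close> by
    \<open>\<bar>x\<bar>\<close> can only increase the functional, which reduces the claim to
    \<open>bound\<close>.\<close>
  have imp: "(a, - w) \<bullet> p \<le> - c" if "\<And>k. g k \<bullet> p \<le> d k" for p
  proof -
    obtain x t where p: "p = (x, t)" by (cases p)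
    have "B *v x \<le> b" "0 \<le> t - \<bar>x\<bar>"
      using that constr[of x t] by (auto simp: p)
    then show ?thesis
      using bound[of x] inner_nonneg_vec[OF \<open>0 \<le> w\<close> \<open>0 \<le> t - \<bar>x\<bar>\<close>]
      by (simp add: p inner_diff_right)
  qed
  have "g k \<bullet> (x0, \<bar>x0\<bar>) \<le> d k" for k
    using constr x0 by auto
  from affine_farkas[of g, OF this imp]
  obtain u where u: "\<And>k. 0 \<le> u k" "(a, - w) = (\<Sum>k\<in>UNIV. u k *\<^sub>R g k)"
      "(\<Sum>k\<in>UNIV. u k * d k) \<le> - c"
    by blast
  define l2 where "l2 = (\<chi> j. u (Inl j))"
  define l4 where "l4 = (\<chi> i. u (Inr (Inl i)))"
  define l5 where "l5 = (\<chi> i. u (Inr (Inr (Inl i))))"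
  define l6 where "l6 = (\<chi> i. u (Inr (Inr (Inr i))))"
  have sum_split: "(\<Sum>k\<in>UNIV. f k) = (\<Sum>j\<in>UNIV. f (Inl j)) + (\<Sum>k\<in>UNIV. f (Inr k))"
    for f :: "'p::finite + 'q::finite \<Rightarrow> 'r::comm_monoid_add"
    by (simp flip: UNIV_Plus_UNIV add: sum.Plus)
  have axis_sum: "(\<Sum>i\<in>UNIV. l $ i *\<^sub>R axis i 1) = l" for l :: "real^'n"
    using basis_expansion[of l] by (simp add: scalar_mult_eq_scaleR)
  have row_sum: "(\<Sum>j\<in>UNIV. l2 $ j *\<^sub>R row j B) = transpose B *v l2"
    by (simp add: vec_eq_iff matrix_vector_mult_def transpose_def row_def mult.commute)
  \<comment> \<open>The first component is the dual equation, the second the splitting of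
    \<open>w\<close>.\<close>
  have sums: "(a, - w) = (\<Sum>j\<in>UNIV. l2 $ j *\<^sub>R (row j B, 0)) +
      ((\<Sum>i\<in>UNIV. l4 $ i *\<^sub>R (axis i 1, - axis i 1)) +
      ((\<Sum>i\<in>UNIV. l5 $ i *\<^sub>R (- axis i 1, - axis i 1)) +
      (\<Sum>i\<in>UNIV. l6 $ i *\<^sub>R (0, - axis i 1))))"
    unfolding u(2) sum_split by (simp add: g_def l2_def l4_def l5_def l6_def)
  have "a = transpose B *v l2 + l4 - l5"
    using arg_cong[OF sums, of fst]
    by (simp add: fst_sum sum_negf axis_sum row_sum)
  moreover have "w = l4 + l5 + l6"
  proof -
    have "- w = - (l4 + l5 + l6)"
      using arg_cong[OF sums, of snd] by (simp add: snd_sum sum_negf axis_sum)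
    then show ?thesis by (metis neg_equal_iff_equal)
  qed
  moreover have "c \<le> - (l2 \<bullet> b)"
    using u(3) by (simp add: sum_split d_def l2_def inner_vec_def)
  ultimately show ?thesis
    using that[of l2 l4 l5 l6] u(1)
    by (simp add: l2_def l4_def l5_def l6_def less_eq_vec_def)
qed

text \<open>
  Only the residual constraint is dualised by separation: the value region over
  the polyhedron \<open>B *v x \<le> b\<close> is separated from the open cylinder of residuals shorter than
  \<open>\<epsilon>\<close> and values below \<open>v\<close>. The Slater residual lies in both projections, so
  the separating hyperplane is not vertical.
\<close>

lemma residual_multiplier:
  fixes A :: "real^'n^'m" and B :: "real^'n^'l"
  assumes "0 \<le> w" and x0: "B *v x0 \<le> b" "norm (y - A *v x0) < \<epsilon>"
    and bound: "\<And>x. x \<in> feasible_set A B y b \<epsilon> \<Longrightarrow> v \<le> w \<bullet> \<bar>x\<bar>"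
  obtains p where "\<And>x. B *v x \<le> b \<Longrightarrow> v + \<epsilon> * norm p \<le> w \<bullet> \<bar>x\<bar> + p \<bullet> (y - A *v x)"
proof -
  define C where "C = {(y - A *v x, r) | x r. B *v x \<le> b \<and> w \<bullet> \<bar>x\<bar> \<le> r}"
  define D where "D = ball (0 :: real^'m) \<epsilon> \<times> {..<v}"
  have C: "(y - A *v x, r) \<in> C" if "B *v x \<le> b" "w \<bullet> \<bar>x\<bar> \<le> r" for x r
    using that by (auto simp: C_def)
  have "0 < \<epsilon>"
    using x0(2) norm_ge_zero order_le_less_trans by blast
  have "convex C"
    unfolding convex_alt
  proof (intro ballI allI impI)
    fix p q and s :: real assume "p \<in> C" "q \<in> C" and s: "0 \<le> s \<and> s \<le> 1"
    then obtain x r x' r' where p: "p = (y - A *v x, r)" "B *v x \<le> b" "w \<bullet> \<bar>x\<bar> \<le> r"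
        and q: "q = (y - A *v x', r')" "B *v x' \<le> b" "w \<bullet> \<bar>x'\<bar> \<le> r'"
      unfolding C_def by blast
    define z where "z = (1 - s) *\<^sub>R x + s *\<^sub>R x'"
    have z: "M *v z = (1 - s) *\<^sub>R (M *v x) + s *\<^sub>R (M *v x')" for M :: "real^'n^'k"
      by (simp add: z_def matrix_vector_right_distrib matrix_vector_mult_scaleR)
    have "B *v z \<le> b"
    proof -
      have "(1 - s) *\<^sub>R (B *v x) + s *\<^sub>R (B *v x') \<le> (1 - s) *\<^sub>R b + s *\<^sub>R b"
        using p q s by (intro add_mono scaleR_left_mono) auto
      then show ?thesis by (simp add: z algebra_simps)
    qed
    moreover have "w \<bullet> \<bar>z\<bar> \<le> (1 - s) * r + s * r'"
    proof -
      have "w \<bullet> \<bar>z\<bar> \<le> w \<bullet> ((1 - s) *\<^sub>R \<bar>x\<bar> + s *\<^sub>R \<bar>x'\<bar>)"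
      proof -
        have "\<bar>z\<bar> \<le> (1 - s) *\<^sub>R \<bar>x\<bar> + s *\<^sub>R \<bar>x'\<bar>"
          using s by (auto simp: z_def less_eq_vec_def abs_vec_def abs_mult
              intro: order_trans[OF abs_triangle_ineq])
        then have "0 \<le> (1 - s) *\<^sub>R \<bar>x\<bar> + s *\<^sub>R \<bar>x'\<bar> - \<bar>z\<bar>" by simp
        from inner_nonneg_vec[OF \<open>0 \<le> w\<close> this] show ?thesis
          by (simp add: inner_diff_right)
      qed
      also have "\<dots> \<le> (1 - s) * r + s * r'"
        using p q s by (auto simp: inner_add_right intro!: add_mono mult_left_mono)
      finally show ?thesis .
    qed
    ultimately have "(y - A *v z, (1 - s) * r + s * r') \<in> C" by (rule C)
    moreover have "y - A *v z = (1 - s) *\<^sub>R (y - A *v x) + s *\<^sub>R (y - A *v x')"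
      by (simp add: z algebra_simps)
    ultimately show "(1 - s) *\<^sub>R p + s *\<^sub>R q \<in> C"
      by (simp add: p q)
  qed
  moreover have "convex D"
    unfolding D_def by (intro convex_Times) auto
  moreover have "C \<noteq> {}"
    using C[OF x0(1) order_refl] by blast
  moreover have "D \<noteq> {}"
    using \<open>0 < \<epsilon>\<close> by (auto simp: D_def)
  moreover have "D \<inter> C = {}"
  proof -
    have False if "B *v x \<le> b" "w \<bullet> \<bar>x\<bar> \<le> r" "norm (y - A *v x) < \<epsilon>" "r < v" for x r
      using bound[of x] that by (auto simp: feasible_set_def)
    then show ?thesis
      by (auto simp: C_def D_def)
  qed
  ultimately obtain h \<beta> where "h \<noteq> 0" and hD: "\<And>z. z \<in> D \<Longrightarrow> h \<bullet> z \<le> \<beta>"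
      and hC: "\<And>z. z \<in> C \<Longrightarrow> \<beta> \<le> h \<bullet> z"
    using separating_hyperplane_sets[of D C] by metis
  obtain p q where h: "h = (p, q)" by (cases h)
  \<comment> \<open>Passing to the closed cylinder gives access to residuals of length exactly
    \<open>\<epsilon>\<close> and to the value \<open>v\<close> itself, as the sharp constant
    requires.\<close>
  have D': "p \<bullet> z + q * r \<le> \<beta>" if "norm z \<le> \<epsilon>" "r \<le> v" for z r
  proof -
    have "closure D = cball 0 \<epsilon> \<times> {..v}"
      using \<open>0 < \<epsilon>\<close> by (simp add: D_def closure_Times)
    moreover have "closure D \<subseteq> {z. h \<bullet> z \<le> \<beta>}"
      using hD by (intro closure_minimal closed_halfspace_le) auto
    moreover have "(z, r) \<in> cball 0 \<epsilon> \<times> {..v}"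
      using that by simp
    ultimately have "(z, r) \<in> {z. h \<bullet> z \<le> \<beta>}"
      by blast
    then show ?thesis by (simp add: h)
  qed
  have C': "\<beta> \<le> p \<bullet> (y - A *v x) + q * r" if "B *v x \<le> b" "w \<bullet> \<bar>x\<bar> \<le> r" for x r
    using hC[OF C[OF that]] by (simp add: h)
  define \<gamma> where "\<gamma> = y - A *v x0"
  have \<gamma>: "norm \<gamma> < \<epsilon>"
    using x0(2) by (simp add: \<gamma>_def)
  \<comment> \<open>Both separation inequalities are taken at the Slater residual, so the
    \<open>p\<close> terms cancel.\<close>
  have q0: "q * r \<le> q * r'" if "w \<bullet> \<bar>x0\<bar> \<le> r'" "r \<le> v" for r r'
    using C'[OF x0(1) that(1)] D'[OF less_imp_le[OF x0(2)] that(2)] by simp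
  have "0 \<le> q"
  proof -
    define r' where "r' = max (w \<bullet> \<bar>x0\<bar>) (v + 1)"
    have "q * v \<le> q * r'"
      by (rule q0) (auto simp: r'_def)
    moreover have "v < r'" by (auto simp: r'_def)
    ultimately show ?thesis by (smt (verit) mult_le_cancel_left)
  qed
  moreover have "q \<noteq> 0"
  proof
    assume "q = 0"
    with \<open>h \<noteq> 0\<close> have "p \<noteq> 0" by (auto simp: h zero_prod_def)
    \<comment> \<open>If the hyperplane were vertical, the interior residual \<open>\<gamma>\<close>
      could still move along \<open>p\<close>; this step stays within radius
      \<open>\<epsilon>\<close> but increases \<open>p \<bullet> \<gamma>\<close> beyond the
      separating value.\<close>
    define \<delta> where "\<delta> = (\<epsilon> - norm \<gamma>) / norm p"
    have "0 < \<delta>"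
      using \<gamma> \<open>p \<noteq> 0\<close> by (simp add: \<delta>_def)
    have "norm (\<gamma> + \<delta> *\<^sub>R p) \<le> norm \<gamma> + norm (\<delta> *\<^sub>R p)"
      by (rule norm_triangle_ineq)
    also have "\<dots> = \<epsilon>"
      using \<open>p \<noteq> 0\<close> \<gamma> by (simp add: \<delta>_def)
    finally have "p \<bullet> (\<gamma> + \<delta> *\<^sub>R p) \<le> \<beta>"
      using D'[of "\<gamma> + \<delta> *\<^sub>R p" v] \<open>q = 0\<close> by simp
    moreover have "\<beta> \<le> p \<bullet> \<gamma>"
      using C'[OF x0(1) order_refl] \<open>q = 0\<close> by (simp add: \<gamma>_def)
    ultimately have "\<delta> * (p \<bullet> p) \<le> 0"
      by (simp add: inner_add_right)
    with \<open>0 < \<delta>\<close> \<open>p \<noteq> 0\<close> show False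
      by (metis inner_gt_zero_iff mult_pos_pos not_less)
  qed
  ultimately have "0 < q" by simp
  show ?thesis
  proof (rule that[of "p /\<^sub>R q"])
    fix x assume x: "B *v x \<le> b"
    \<comment> \<open>The term \<open>\<epsilon> * norm p\<close> is the maximum of \<open>p\<close>
      over the ball of radius \<open>\<epsilon>\<close>, attained in the direction of
      \<open>p\<close>. Dividing by \<open>q\<close> later makes the value coefficient 1.\<close>
    have "\<epsilon> * norm p + q * v \<le> \<beta>"
    proof (cases "p = 0")
      case True
      then show ?thesis using D'[of 0 v] \<open>0 < \<epsilon>\<close> by simp
    next
      case False
      have "p \<bullet> ((\<epsilon> / norm p) *\<^sub>R p) = \<epsilon> * norm p"
        by (simp add: dot_square_norm power2_eq_square)
      then show ?thesis using D'[of "(\<epsilon> / norm p) *\<^sub>R p" v] False \<open>0 < \<epsilon>\<close> by simp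
    qed
    also have "\<beta> \<le> p \<bullet> (y - A *v x) + q * (w \<bullet> \<bar>x\<bar>)"
      using C'[OF x order_refl] .
    finally have "(\<epsilon> * norm p + q * v) / q \<le> (p \<bullet> (y - A *v x) + q * (w \<bullet> \<bar>x\<bar>)) / q"
      using \<open>0 < q\<close> by (intro divide_right_mono) auto
    moreover have "(\<epsilon> * norm p + q * v) / q = v + \<epsilon> * norm (p /\<^sub>R q)"
      using \<open>0 < q\<close> by (simp add: field_simps)
    moreover have "(p \<bullet> (y - A *v x) + q * (w \<bullet> \<bar>x\<bar>)) / q =
        w \<bullet> \<bar>x\<bar> + (p /\<^sub>R q) \<bullet> (y - A *v x)"
      using \<open>0 < q\<close> by (simp add: field_simps)
    ultimately show "v + \<epsilon> * norm (p /\<^sub>R q) \<le> w \<bullet> \<bar>x\<bar> + (p /\<^sub>R q) \<bullet> (y - A *v x)"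
      by simp
  qed
qed

text \<open>The residual multiplier \<open>p\<close> serves as \<open>lam3\<close> with
  \<open>lam1 = norm p\<close>, and the polyhedral multipliers fill the other slots. Taking
  \<open>v\<close> to be the primal minimum gives a dual point attaining it.\<close>

lemma strong_duality:
  fixes A :: "real^'n^'m" and B :: "real^'n^'l"
  assumes "slater_condition A B y b \<epsilon>" and "0 \<le> w"
    and bound: "\<And>x. x \<in> feasible_set A B y b \<epsilon> \<Longrightarrow> v \<le> w \<bullet> \<bar>x\<bar>"
  obtains \<mu> :: "('l, 'm, 'n) dual_var"
  where "dual_feasible A B w \<mu>" "v \<le> dual_objective y b \<epsilon> \<mu>"
proof -
  obtain x0 \<gamma> where x0: "B *v x0 \<le> b" "norm \<gamma> < \<epsilon>" "y = A *v x0 + \<gamma>"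
    using assms(1) by (auto simp: slater_condition_def)
  then have "norm (y - A *v x0) < \<epsilon>" by simp
  then obtain p where p: "\<And>x. B *v x \<le> b \<Longrightarrow> v + \<epsilon> * norm p \<le> w \<bullet> \<bar>x\<bar> + p \<bullet> (y - A *v x)"
    using residual_multiplier[OF \<open>0 \<le> w\<close> x0(1) _ bound] by metis
  have "v + \<epsilon> * norm p - p \<bullet> y \<le> w \<bullet> \<bar>x\<bar> - (transpose A *v p) \<bullet> x" if "B *v x \<le> b" for x
    using p[OF that] by (simp add: dot_lmul_matrix inner_diff_right)
  then obtain l2 l4 l5 l6 where l: "0 \<le> l2" "0 \<le> l4" "0 \<le> l5" "0 \<le> l6"
      "transpose A *v p = transpose B *v l2 + l4 - l5" "w = l4 + l5 + l6"
      "v + \<epsilon> * norm p - p \<bullet> y \<le> - (l2 \<bullet> b)"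
    using polyhedral_multipliers[OF \<open>0 \<le> w\<close> x0(1)] by metis
  show ?thesis
  proof (rule that)
    let ?\<mu> = "\<lparr>lam1 = norm p, lam2 = l2, lam3 = p, lam4 = l4, lam5 = l5, lam6 = l6\<rparr>"
    show "dual_feasible A B w ?\<mu>"
      using l by (simp add: dual_feasible_def)
    show "v \<le> dual_objective y b \<epsilon> ?\<mu>"
      using l by (simp add: dual_objective_def algebra_simps)
  qed
qed

section \<open>Counting supports of complementary vectors\<close>

text \<open>A sum of nonnegative terms that is at most zero vanishes termwise, so the two supports
  are disjoint.\<close>

lemma complementary_l0_norm:
  fixes x s :: "real^'n"
  assumes "0 \<le> s" and "s \<bullet> \<bar>x\<bar> \<le> 0"
  shows "l0_norm x + l0_norm s \<le> CARD('n)"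
proof -
  have nonneg: "0 \<le> s $ i * \<bar>x $ i\<bar>" for i
    using assms(1) by (simp add: less_eq_vec_def)
  moreover have "(\<Sum>i\<in>UNIV. s $ i * \<bar>x $ i\<bar>) \<le> 0"
    using assms(2) by (simp add: inner_vec_def abs_vec_def)
  ultimately have "(\<Sum>i\<in>UNIV. s $ i * \<bar>x $ i\<bar>) = 0"
    by (meson antisym sum_nonneg)
  then have "s $ i * \<bar>x $ i\<bar> = 0" for i
    using nonneg by (simp add: sum_nonneg_eq_0_iff)
  then have "{i. x $ i \<noteq> 0} \<inter> {i. s $ i \<noteq> 0} = {}" by auto
  then have "l0_norm x + l0_norm s = card ({i. x $ i \<noteq> 0} \<union> {i. s $ i \<noteq> 0})"
    by (simp add: l0_norm_def card_Un_disjoint)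
  also have "\<dots> \<le> CARD('n)" by (rule card_mono) auto
  finally show ?thesis .
qed

text \<open>Strict positivity makes the two supports cover all indices.\<close>

lemma strictly_complementary_l0_norm:
  fixes x s :: "real^'n"
  assumes "strictly_complementary x s"
  shows "CARD('n) \<le> l0_norm x + l0_norm s"
proof -
  have "0 < (\<bar>x\<bar> + s) $ i" for i
    using assms by (auto simp: strictly_complementary_def)
  then have "x $ i \<noteq> 0 \<or> s $ i \<noteq> 0" for i
    by (metis add.right_neutral vector_add_component abs_vec_def vec_lambda_beta abs_zero less_irrefl)
  then have "{i. x $ i \<noteq> 0} \<union> {i. s $ i \<noteq> 0} = UNIV" by auto
  then show ?thesis
    unfolding l0_norm_def by (metis card_Un_le)
qed

section \<open>Optimal bilevel weights yield sparsest points\<close>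

theorem theorem4:
  fixes A :: "real^'n^'m" and B :: "real^'n^'l"
    and y :: "real^'m" and b :: "real^'l" and \<epsilon> :: real
    and T :: "(real^'n) set"
    and w_star :: "real^'n" and \<mu>_star :: "('l, 'm, 'n) dual_var" and x_star :: "real^'n"
  assumes "CARD('m) < CARD('n)" and "CARD('l) \<le> CARD('n)" and "0 \<le> \<epsilon>"
    and T_def: "T = feasible_set A B y b \<epsilon>"
    and slater: "slater_condition A B y b \<epsilon>"
    and weight: "\<And>\<nu>. sparsest_point T \<nu> \<Longrightarrow>
      \<exists>w_bar. 0 \<le> w_bar \<and>
        (\<exists>x_bar. weighted_l1_solution T w_bar x_bar \<and> l0_norm x_bar = l0_norm \<nu> \<and>
          (\<exists>\<mu>_bar. dual_solution A B y b \<epsilon> w_bar \<mu>_bar \<and>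
            strictly_complementary x_bar (lam6 \<mu>_bar))) \<and>
        \<bar>weighted_l1_value T w_bar\<bar> \<noteq> \<infinity> \<and> 0 < weighted_l1_value T w_bar"
    and bilevel: "bilevel_solution A B y b \<epsilon> (w_star, \<mu>_star)"
    and opt: "weighted_l1_solution T w_star x_star"
  shows "sparsest_point T x_star"
proof -
  obtain \<nu> where \<nu>: "sparsest_point T \<nu>"
  proof -
    have "x_star \<in> T"
      using opt by (simp add: weighted_l1_solution_def is_arg_min_def)
    \<comment> \<open>A sparsest point exists because \<open>l0_norm\<close> takes natural values
      and \<open>x_star\<close> shows that \<open>T\<close> is nonempty.\<close>
    then have "is_arg_min l0_norm (\<lambda>z. z \<in> T) (arg_min l0_norm (\<lambda>z. z \<in> T))"
      by (metis arg_min_nat_lemma is_arg_min_linorder)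
    then show ?thesis
      using that by (simp add: sparsest_point_def)
  qed
  then obtain w x and \<mu> :: "('l, 'm, 'n) dual_var" where "0 \<le> w"
      and x: "weighted_l1_solution T w x" and x_sparse: "l0_norm x = l0_norm \<nu>"
      and \<mu>: "dual_solution A B y b \<epsilon> w \<mu>"
      and sc: "strictly_complementary x (lam6 \<mu>)"
    using weight by blast
  have "bilevel_feasible A B y b \<epsilon> (w, \<mu>)"
  proof -
    have "w \<bullet> \<bar>x\<bar> \<le> w \<bullet> \<bar>z\<bar>" if "z \<in> T" for z
      using x that \<open>0 \<le> w\<close>
      by (auto simp: weighted_l1_solution_def is_arg_min_linorder l1_norm_diag_mat)
    then obtain \<mu>' :: "('l, 'm, 'n) dual_var"
      where "dual_feasible A B w \<mu>'" "w \<bullet> \<bar>x\<bar> \<le> dual_objective y b \<epsilon> \<mu>'"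
      using strong_duality[OF slater \<open>0 \<le> w\<close>, of "w \<bullet> \<bar>x\<bar>"] T_def by metis
    moreover have feas: "dual_feasible A B w \<mu>"
      using \<mu> by (simp add: dual_solution_def is_arg_max_def)
    \<comment> \<open>Strong duality only provides some dual point \<open>\<mu>'\<close>; optimality
      of \<open>\<mu>\<close> transfers its bound to the strictly complementary solution.\<close>
    ultimately have "w \<bullet> \<bar>x\<bar> \<le> dual_objective y b \<epsilon> \<mu>"
      using \<mu> unfolding dual_solution_def is_arg_max_linorder by fastforce
    moreover have "dual_objective y b \<epsilon> \<mu> \<le> w \<bullet> \<bar>x\<bar>"
    proof -
      have "x \<in> feasible_set A B y b \<epsilon>"
        using x T_def by (simp add: weighted_l1_solution_def is_arg_min_def)
      moreover have "0 \<le> lam6 \<mu> \<bullet> \<bar>x\<bar>"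
        using feas by (intro inner_nonneg_vec) (auto simp: dual_feasible_def)
      ultimately show ?thesis
        using weak_duality[OF feas] by fastforce
    qed
    ultimately have "weighted_l1_min T w (dual_objective y b \<epsilon> \<mu>)"
      unfolding weighted_l1_min_def using x \<open>0 \<le> w\<close> by (auto simp: l1_norm_diag_mat)
    then show ?thesis
      using feas \<open>0 \<le> w\<close> by (simp add: bilevel_feasible_def T_def)
  qed
  then have card: "l0_norm (lam6 \<mu>) \<le> l0_norm (lam6 \<mu>_star)"
    using bilevel by (auto simp: bilevel_solution_def is_arg_max_linorder)
  have feas: "dual_feasible A B w_star \<mu>_star" and "0 \<le> w_star"
    and "weighted_l1_min T w_star (dual_objective y b \<epsilon> \<mu>_star)"
    using bilevel by (auto simp: bilevel_solution_def is_arg_max_def bilevel_feasible_def T_def)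
  \<comment> \<open>Bilevel feasibility names an unspecified minimiser; all minimisers share one
    value, so \<open>x_star\<close> may replace it.\<close>
  then have "dual_objective y b \<epsilon> \<mu>_star = w_star \<bullet> \<bar>x_star\<bar>"
    using opt unfolding weighted_l1_min_def weighted_l1_solution_def is_arg_min_linorder
    by (metis antisym l1_norm_diag_mat)
  moreover have "x_star \<in> T"
    using opt by (simp add: weighted_l1_solution_def is_arg_min_def)
  ultimately have "lam6 \<mu>_star \<bullet> \<bar>x_star\<bar> \<le> 0"
    using weak_duality[OF feas, of x_star] T_def by fastforce
  then have "l0_norm x_star + l0_norm (lam6 \<mu>_star) \<le> CARD('n)"
    using feas by (intro complementary_l0_norm) (auto simp: dual_feasible_def)
  with card strictly_complementary_l0_norm[OF sc] have "l0_norm x_star \<le> l0_norm \<nu>"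
    by (simp add: x_sparse)
  with \<nu> \<open>x_star \<in> T\<close> show ?thesis
    unfolding sparsest_point_def by (metis is_arg_min_antimono)
qed

end
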